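(* Let $A\in\mathbb{R}^{m\times n}$, $b\in\mathbb{R}^m$ satisfy the genericity condition $\widetilde\sigma_n>\sigma_{n+1}$, let $x$ be the unique TLS solution, $r=b-Ax$, $P=A^\top A-\sigma_{n+1}^2I_n$, and let $L\in\mathbb{R}^{k\times n}$, $k\le n$. Put $$\mathcal N=P^{-1}\left[-x^\top\otimes\left(A^\top+\frac{2xr^\top}{1+x^\top x}\right)+I_n\otimes r^\top\right],\qquad \mathcal H=P^{-1}\left[A^\top+\frac{2xr^\top}{1+x^\top x}\right].$$ When the solution space $\mathbb{R}^k$ is equipped with the componentwise norm $$\|u\|_c=\min\{\omega:\ |u_i|\le\omega\,|(Lx)_i|,\ i=1,\dots,k\}=\max\{|u_i|/|(Lx)_i|,\ i=1,\dots,k\},$$ the (componentwise) condition number of $\Psi(A,b)=Lx$ is $$\kappa_c=\left\|D_{Lx}^\dagger\left(|L\mathcal N|\,\mathrm{vec}(|A|)+|L\mathcal H|\,|b|\right)\right\|_\infty .$$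
   Context: Let $m>n$. The total least squares (TLS) problem for $A\in\mathbb{R}^{m\times n}$, $b\in\mathbb{R}^m$ is to minimize $\|[A,b]-[\widehat A,\widehat b]\|_F$ over $[\widehat A,\widehat b]\in\mathbb{R}^{m\times(n+1)}$ with $\widehat b$ in the range of $\widehat A$; any $x$ with $\widehat A x=\widehat b$ for a minimizer is a TLS solution. Let $\widetilde\sigma_n$ be the smallest singular value of $A$ and $\sigma_{n+1}$ the smallest singular value of $[A,b]$. Under the genericity condition $\widetilde\sigma_n>\sigma_{n+1}$ there is a unique TLS solution $x$; it satisfies $(A^\top A-\sigma_{n+1}^2I_n)x=A^\top b$. $\Psi(A,b)=Lx$ is defined on data satisfying the genericity condition; it is known to be Fréchet differentiable there, with derivative $$\mathsf d\Psi(A,b)\cdot(\mathsf dA,\mathsf db)=LP^{-1}\left[(\mathsf dA)^\top r-\left(A^\top+\tfrac{2xr^\top}{1+x^\top x}\right)\mathsf dA\,x\right]+LP^{-1}\left(A^\top+\tfrac{2xr^\top}{1+x^\top x}\right)\mathsf db .$$ Componentwise norm on the data space: $\|(\mathsf dA,\mathsf db)\|_c=\min\{\omega\ge0: |\mathsf dA|\le\omega|A|,\ |\mathsf db|\le\omega|b|\}$ (entrywise), and $=\infty$ if no such $\omega$ exists. The condition number is $\kappa_c=\max_{\|(\mathsf dA,\mathsf db)\|_c=1}\|\mathsf d\Psi(A,b)\cdot(\mathsf dA,\mathsf db)\|_{c}$, with the componentwise norm relative to $Lx$ on $\mathbb{R}^k$. Convention on zero components: if $(Lx)_i=0$ for some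 $i$, it is assumed that the $i$th component of $\mathsf d\Psi(A,b)\cdot(\mathsf dA,\mathsf db)$ vanishes for all perturbations of finite componentwise norm, and the quotient $0/0$ is read as $0$. $|\cdot|$ is the entrywise absolute value, $\otimes$ the Kronecker product $[a_{ij}B]$, $\mathrm{vec}$ stacks columns, $D_{Lx}$ is the diagonal matrix with diagonal $Lx$, and $\dagger$ denotes the Moore–Penrose inverse. *)

theory Defs
  imports "HOL-Analysis.Analysis"
begin

text \<open>
  Conventions: a real \<open>p\<close> by \<open>q\<close> matrix has type \<^typ>\<open>real^'q^'p\<close>. The library's instances
  on this type are used throughout: \<open>norm\<close> is the Frobenius norm, and
  \<open>\<bar>M\<bar>\<close> and \<open>M \<le> M'\<close> are entrywise.
\<close>

text \<open>The matrix \<open>[A, b]\<close>; the extra column has index \<^const>\<open>None\<close>.\<close>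

definition augment :: "real^'n^'m \<Rightarrow> real^'m \<Rightarrow> real^('n option)^'m" where
  "augment A b = (\<chi> i j. case j of None \<Rightarrow> b $ i | Some l \<Rightarrow> A $ i $ l)"

text \<open>
  Singular values via pairs of singular vectors. Both equations are needed:
  a rectangular matrix with more rows than columns has 0 as a singular value
  only if it is column-rank deficient.
\<close>

definition singular_value :: "real^'n^'m \<Rightarrow> real \<Rightarrow> bool" where
  "singular_value M s \<longleftrightarrow> 0 \<le> s \<and>
     (\<exists>u v. norm u = 1 \<and> norm v = 1 \<and> M *v v = s *\<^sub>R u \<and> transpose M *v u = s *\<^sub>R v)"

definition smallest_singular_value :: "real^'n^'m \<Rightarrow> real" where
  "smallest_singular_value M = (LEAST s. singular_value M s)"

definition moore_penrose :: "real^'n^'m \<Rightarrow> real^'m^'n \<Rightarrow> bool" where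
  "moore_penrose M X \<longleftrightarrow> M ** X ** M = M \<and> X ** M ** X = X \<and>
     transpose (M ** X) = M ** X \<and> transpose (X ** M) = X ** M"

definition pinv :: "real^'n^'m \<Rightarrow> real^'m^'n" where
  "pinv M = (THE X. moore_penrose M X)"

definition diag :: "real^'k \<Rightarrow> real^'k^'k" where
  "diag y = (\<chi> i j. if i = j then y $ i else 0)"

definition outer_product :: "real^'n \<Rightarrow> real^'m \<Rightarrow> real^'m^'n" where
  "outer_product x y = (columnvector x :: real^1^'n) ** rowvector y"

text \<open>
  Kronecker product \<open>[a\<^sub>i\<^sub>j B]\<close>: rows and columns are indexed by pairs
  (block index, index within the block). Likewise \<open>vec M\<close>, the stacked columns of \<open>M\<close>,
  is indexed by pairs (column, row), the column being the block index.
\<close>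

definition kronecker :: "real^'q^'p \<Rightarrow> real^'t^'s \<Rightarrow> real^('q \<times> 't)^('p \<times> 's)" where
  "kronecker A B = (\<chi> p q. A $ fst p $ fst q * B $ snd p $ snd q)"

definition vec_cols :: "real^'n^'m \<Rightarrow> real^('n \<times> 'm)" where
  "vec_cols M = (\<chi> p. M $ snd p $ fst p)"

text \<open>
  The row types \<^typ>\<open>1 \<times> 'n\<close> and \<^typ>\<open>'n \<times> 1\<close> of \<open>x\<^sup>T \<otimes> B\<close> and \<open>C \<otimes> r\<^sup>T\<close>
  are identified with \<^typ>\<open>'n\<close>.
\<close>

definition row_kronecker :: "real^'q \<Rightarrow> real^'t^'n \<Rightarrow> real^('q \<times> 't)^'n" where
  "row_kronecker x B = (\<chi> i. kronecker (rowvector x :: real^'q^1) B $ (1, i))"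

definition kronecker_row :: "real^'q^'n \<Rightarrow> real^'t \<Rightarrow> real^('q \<times> 't)^'n" where
  "kronecker_row C r = (\<chi> i. kronecker C (rowvector r :: real^'t^1) $ (i, 1))"

definition tls_feasible :: "real^'n^'m \<Rightarrow> real^'m \<Rightarrow> bool" where
  "tls_feasible A' b' \<longleftrightarrow> b' \<in> range (\<lambda>x. A' *v x)"

definition tls_minimizer ::
  "real^'n^'m \<Rightarrow> real^'m \<Rightarrow> real^'n^'m \<Rightarrow> real^'m \<Rightarrow> bool" where
  "tls_minimizer A b A' b' \<longleftrightarrow> tls_feasible A' b' \<and>
     (\<forall>A'' b''. tls_feasible A'' b'' \<longrightarrow>
        norm (augment A b - augment A' b') \<le> norm (augment A b - augment A'' b''))"

definition is_tls_solution :: "real^'n^'m \<Rightarrow> real^'m \<Rightarrow> real^'n \<Rightarrow> bool" where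
  "is_tls_solution A b x \<longleftrightarrow> (\<exists>A' b'. tls_minimizer A b A' b' \<and> A' *v x = b')"

definition tls_generic :: "real^'n^'m \<Rightarrow> real^'m \<Rightarrow> bool" where
  "tls_generic A b \<longleftrightarrow> smallest_singular_value A > smallest_singular_value (augment A b)"

text \<open>
  \<open>tls_solution\<close> and \<open>tls_map\<close> are meaningful only on generic data, where the solution
  is unique.
\<close>

definition tls_solution :: "real^'n^'m \<Rightarrow> real^'m \<Rightarrow> real^'n" where
  "tls_solution A b = (THE x. is_tls_solution A b x)"

definition tls_map :: "real^'n^'k \<Rightarrow> (real^'n^'m) \<times> (real^'m) \<Rightarrow> real^'k" where
  "tls_map L = (\<lambda>(A, b). L *v tls_solution A b)"

definition tls_deriv ::
  "real^'n^'k \<Rightarrow> real^'n^'m \<Rightarrow> real^'m \<Rightarrow> (real^'n^'m) \<times> (real^'m) \<Rightarrow> real^'k" where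
  "tls_deriv L A b = frechet_derivative (tls_map L) (at (A, b))"

definition data_cnorm ::
  "(real^'n^'m) \<times> (real^'m) \<Rightarrow> (real^'n^'m) \<times> (real^'m) \<Rightarrow> ereal" where
  "data_cnorm = (\<lambda>(A, b) (dA, db).
     if \<exists>\<omega>\<ge>0. \<bar>dA\<bar> \<le> \<omega> *\<^sub>R \<bar>A\<bar> \<and> \<bar>db\<bar> \<le> \<omega> *\<^sub>R \<bar>b\<bar>
     then ereal (LEAST \<omega>. 0 \<le> \<omega> \<and> \<bar>dA\<bar> \<le> \<omega> *\<^sub>R \<bar>A\<bar> \<and> \<bar>db\<bar> \<le> \<omega> *\<^sub>R \<bar>b\<bar>)
     else \<infinity>)"

text \<open>The norm of \<open>u\<close> relative to \<open>y\<close>.\<close>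

definition sol_cnorm :: "real^'k \<Rightarrow> real^'k \<Rightarrow> ereal" where
  "sol_cnorm y u =
     (if \<exists>\<omega>\<ge>0. \<forall>i. \<bar>u $ i\<bar> \<le> \<omega> * \<bar>y $ i\<bar>
      then ereal (LEAST \<omega>. 0 \<le> \<omega> \<and> (\<forall>i. \<bar>u $ i\<bar> \<le> \<omega> * \<bar>y $ i\<bar>))
      else \<infinity>)"

text \<open>
  The form with quotients; here 0/0 is read as 0, which is also the value of division by
  zero in HOL.
\<close>

lemma sol_cnorm_eq_Max:
  fixes y u :: "real^'k"
  assumes "\<And>i. y $ i = 0 \<Longrightarrow> u $ i = 0"
  shows "sol_cnorm y u = ereal (MAX i. \<bar>u $ i\<bar> / \<bar>y $ i\<bar>)"
proof -
  define c where "c = (MAX i. \<bar>u $ i\<bar> / \<bar>y $ i\<bar>)"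
  have iff: "(0 \<le> w \<and> (\<forall>i. \<bar>u $ i\<bar> \<le> w * \<bar>y $ i\<bar>)) \<longleftrightarrow> c \<le> w" for w
  proof
    assume w: "0 \<le> w \<and> (\<forall>i. \<bar>u $ i\<bar> \<le> w * \<bar>y $ i\<bar>)"
    have "\<bar>u $ i\<bar> / \<bar>y $ i\<bar> \<le> w" for i
      using w by (cases "y $ i = 0") (auto simp: pos_divide_le_eq)
    then show "c \<le> w" unfolding c_def by (subst Max_le_iff) auto
  next
    assume "c \<le> w"
    then have *: "\<bar>u $ i\<bar> / \<bar>y $ i\<bar> \<le> w" for i
      unfolding c_def by (subst (asm) Max_le_iff) auto
    have "\<bar>u $ i\<bar> \<le> w * \<bar>y $ i\<bar>" for i
      using *[of i] assms[of i] by (cases "y $ i = 0") (auto simp: pos_divide_le_eq)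
    moreover have "0 \<le> \<bar>u $ undefined\<bar> / \<bar>y $ undefined\<bar>" by simp
    then have "0 \<le> w" using *[of undefined] by linarith
    ultimately show "0 \<le> w \<and> (\<forall>i. \<bar>u $ i\<bar> \<le> w * \<bar>y $ i\<bar>)" by blast
  qed
  have "(LEAST w. 0 \<le> w \<and> (\<forall>i. \<bar>u $ i\<bar> \<le> w * \<bar>y $ i\<bar>)) = c"
    unfolding iff by (rule Least_equality) auto
  moreover have "\<exists>w\<ge>0. \<forall>i. \<bar>u $ i\<bar> \<le> w * \<bar>y $ i\<bar>"
    using iff[of c] by auto
  ultimately show ?thesis by (simp add: sol_cnorm_def c_def)
qed

text \<open>\<open>GREATEST\<close> rather than a supremum: the condition number is a maximum.\<close>

definition tls_cond :: "real^'n^'k \<Rightarrow> real^'n^'m \<Rightarrow> real^'m \<Rightarrow> ereal" where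
  "tls_cond L A b = (GREATEST \<kappa>. \<exists>dA db. data_cnorm (A, b) (dA, db) = 1 \<and>
     \<kappa> = sol_cnorm (tls_map L (A, b)) (tls_deriv L A b (dA, db)))"

end

theory Submission
  imports Defs
begin

text \<open>
  Write \<open>C = [A, b]\<close> and let \<open>\<sigma>\<close> be its smallest singular value, which is the minimal gain of \<open>C\<close>
  on unit vectors. A consistent system \<open>[A', b']\<close> kills some \<open>(y, -1)\<close>, so its distance from \<open>C\<close>
  is at least \<open>\<sigma>\<close>; a rank-one correction attains this bound, because under genericity the minimizing
  vector has a nonzero last entry. Hence \<open>x\<close> is a TLS solution only if \<open>(x, -1)\<close> has minimal gain,
  which is an eigenvector equation for \<open>C\<^sup>T C\<close> (\<open>tls_solution_equation\<close>). It determines \<open>x\<close>, because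
  \<open>P = A\<^sup>T A - \<sigma>\<^sup>2 I\<close> is positive definite.

  For the derivative, compare the solutions \<open>x\<close> and \<open>x'\<close> of two sets of data. Testing the equation of
  each with the other one gives an exact formula for the change of \<open>\<sigma>\<^sup>2\<close>, and with it an exact formula
  for \<open>P (x' - x)\<close>, in which each term is an increment of the data times a factor depending on \<open>x'\<close>
  (\<open>tls_solution_increment\<close>). Therefore continuity of the solution, which follows from the
  coercivity of \<open>P\<close>, already gives Frechet differentiability and the value of the derivative
  (\<open>tls_solution_has_derivative\<close>).

  In coordinates the derivative of \<open>L x\<close> is \<open>L N vec(dA) + L H db\<close>. Over the data perturbations with
  \<open>\<bar>dA\<bar> \<le> \<bar>A\<bar>\<close> and \<open>\<bar>db\<bar> \<le> \<bar>b\<bar>\<close> the modulus of its \<open>i\<close>-th component is at most the \<open>i\<close>-th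
  component of \<open>\<bar>L N\<bar> vec \<bar>A\<bar> + \<bar>L H\<bar> \<bar>b\<bar>\<close>, with equality when the signs of the perturbation
  match those of row \<open>i\<close> (\<open>sign_aligned_perturbation\<close>). Dividing by \<open>\<bar>(L x)\<^sub>i\<bar>\<close> and maximizing over
  \<open>i\<close> gives the condition number. At a zero component of \<open>L x\<close> both sides contribute 0: the
  componentwise norm by the convention on zero components, and the right-hand side because the
  pseudoinverse of the diagonal matrix has a zero there.
\<close>

section \<open>The smallest singular value as minimal gain\<close>

lemma norm_matrix_vector_mult_le:
  fixes M :: "real^'p^'q"
  shows "norm (M *v v) \<le> norm M * norm v"
proof -
  have "norm (M *v v) = L2_set (\<lambda>i. M $ i \<bullet> v) UNIV"
    by (simp add: norm_vec_def L2_set_def matrix_vector_mul_component)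
  also have "\<dots> \<le> L2_set (\<lambda>i. norm (M $ i) * norm v) UNIV"
    unfolding L2_set_def
    by (intro real_sqrt_le_mono sum_mono) (metis Cauchy_Schwarz_ineq2 power2_abs power_mono abs_ge_zero)
  also have "\<dots> = norm M * norm v"
    by (simp add: norm_vec_def[of M] L2_set_left_distrib)
  finally show ?thesis .
qed

lemma minimal_gain_exists:
  fixes M :: "real^'p^'q"
  obtains v where "norm v = 1" and "\<And>u. norm (M *v v) * norm u \<le> norm (M *v u)"
proof -
  have "continuous_on (sphere 0 1) (\<lambda>v. norm (M *v v))"
    by (intro continuous_intros matrix_vector_mult_linear_continuous_on)
  moreover have "sphere (0::real^'p) 1 \<noteq> {}"
    by (simp)
  ultimately obtain v where v: "v \<in> sphere 0 1"
    and min: "\<And>u. u \<in> sphere 0 1 \<Longrightarrow> norm (M *v v) \<le> norm (M *v u)"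
    using continuous_attains_inf[OF compact_sphere] by metis
  show ?thesis
  proof
    show "norm v = 1" using v by simp
    show "norm (M *v v) * norm u \<le> norm (M *v u)" for u
    proof (cases "u = 0")
      case False
      then have "norm (M *v v) \<le> norm (M *v ((1 / norm u) *\<^sub>R u))"
        by (intro min) simp
      also have "\<dots> = norm (M *v u) / norm u"
        by (simp add: matrix_vector_mult_scaleR)
      finally show ?thesis
        using False by (simp add: pos_le_divide_eq)
    qed simp
  qed
qed

text \<open>
  \<open>\<lambda>u. (norm (M *v u))\<^sup>2 - s\<^sup>2 * (norm u)\<^sup>2\<close> is a nonnegative quadratic form which vanishes at
  \<open>w\<close>, so its first variation at \<open>w\<close> vanishes in every direction \<open>h\<close>.
\<close>

lemma minimal_gain_first_variation:
  fixes M :: "real^'p^'q"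
  assumes lower: "\<And>u. s * norm u \<le> norm (M *v u)" and "0 \<le> s"
    and w: "norm (M *v w) \<le> s * norm w"
  shows "(M *v w) \<bullet> (M *v h) = s\<^sup>2 * (w \<bullet> h)"
proof -
  define a where "a = (M *v w) \<bullet> (M *v h) - s\<^sup>2 * (w \<bullet> h)"
  define c where "c = (M *v h) \<bullet> (M *v h) - s\<^sup>2 * (h \<bullet> h)"
  have form_nonneg: "0 \<le> (M *v u) \<bullet> (M *v u) - s\<^sup>2 * (u \<bullet> u)" for u
    using power_mono[OF lower[of u], of 2] \<open>0 \<le> s\<close>
    by (simp add: power_mult_distrib dot_square_norm)
  have "(M *v w) \<bullet> (M *v w) - s\<^sup>2 * (w \<bullet> w) \<le> 0"
    using power_mono[OF w, of 2] \<open>0 \<le> s\<close>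
    by (simp add: power_mult_distrib dot_square_norm)
  then have zero: "(M *v w) \<bullet> (M *v w) - s\<^sup>2 * (w \<bullet> w) = 0"
    using form_nonneg[of w] by simp
  have line: "0 \<le> 2 * t * a + t\<^sup>2 * c" for t
  proof -
    have "0 \<le> (M *v (w + t *\<^sub>R h)) \<bullet> (M *v (w + t *\<^sub>R h)) - s\<^sup>2 * ((w + t *\<^sub>R h) \<bullet> (w + t *\<^sub>R h))"
      by (rule form_nonneg)
    also have "\<dots> = ((M *v w) \<bullet> (M *v w) - s\<^sup>2 * (w \<bullet> w)) + 2 * t * a + t\<^sup>2 * c"
      unfolding a_def c_def
      by (simp add: matrix_vector_right_distrib matrix_vector_mult_scaleR inner_add_left
          inner_add_right inner_commute[of "M *v h" "M *v w"] inner_commute[of h w]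
          algebra_simps power2_eq_square)
    finally show ?thesis using zero by simp
  qed
  have "c \<ge> 0" unfolding c_def by (rule form_nonneg)
  define k where "k = 1 / (c + 1)"
  have "0 < k" "k * c \<le> 1"
    using \<open>c \<ge> 0\<close> by (simp_all add: k_def)
  \<comment> \<open>the parabola takes a negative value at \<open>t = - a / (c + 1)\<close> unless \<open>a = 0\<close>\<close>
  have "k * (2 - k * c) * a\<^sup>2 \<le> 0"
    using line[of "- a * k"] by (simp add: algebra_simps power2_eq_square)
  then have "a = 0"
    using \<open>0 < k\<close> \<open>k * c \<le> 1\<close> by (simp add: mult_le_0_iff)
  then show ?thesis unfolding a_def by simp
qed

text \<open>
  This supplies the left singular vector for the singular value 0. Without a left kernel the
  transpose would be injective, hence by dimensions onto; then \<open>v\<close> would lie in the row space of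
  \<open>M\<close>, which is orthogonal to every vector that \<open>M\<close> kills.
\<close>

lemma left_kernel_nontrivial:
  fixes M :: "real^'p^'q"
  assumes "CARD('p) \<le> CARD('q)" and "M *v v = 0" and "v \<noteq> 0"
  obtains u where "norm u = 1" and "transpose M *v u = 0"
proof -
  have "\<exists>u. u \<noteq> 0 \<and> transpose M *v u = 0"
  proof (rule ccontr)
    assume "\<not> ?thesis"
    then have inj: "inj ((*v) (transpose M))"
      by (auto simp: linear_injective_0)
    have "dim (range ((*v) (transpose M))) = dim (UNIV :: (real^'q) set)"
      using inj by (intro dim_image_eq) auto
    then have "dim (range ((*v) (transpose M))) \<ge> DIM(real^'p)"
      using assms(1) by simp
    then have "range ((*v) (transpose M)) = UNIV"
      by (metis dim_eq_full dim_subset_UNIV linear_subspace_image le_antisym matrix_vector_mul_linear span_eq_iff subspace_UNIV)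
    then obtain u where "v = transpose M *v u" by (metis surjD)
    then have "v \<bullet> v = u \<bullet> (M *v v)"
      by (metis dot_lmul_matrix vector_transpose_matrix transpose_transpose inner_commute)
    then show False using assms by simp
  qed
  then obtain u where "u \<noteq> 0" "transpose M *v u = 0" by blast
  then show ?thesis
    using that[of "(1 / norm u) *\<^sub>R u"] by (simp add: matrix_vector_mult_scaleR)
qed

text \<open>
  When the minimal gain \<open>s\<close> is positive, \<open>M *v v\<close> divided by \<open>s\<close> is the left singular vector. When
  \<open>s\<close> is 0 any unit left null vector serves, and the number of rows guarantees one.
  No singular value lies below \<open>s\<close>, since each one is the gain of a unit vector.
\<close>

lemma smallest_singular_value_eq_minimal_gain:
  fixes M :: "real^'p^'q"
  assumes "CARD('p) \<le> CARD('q)" and "norm v = 1"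
    and min: "\<And>u. norm (M *v v) * norm u \<le> norm (M *v u)"
  shows "smallest_singular_value M = norm (M *v v)"
  unfolding smallest_singular_value_def
proof (rule Least_equality)
  define s where "s = norm (M *v v)"
  show "singular_value M (norm (M *v v))"
  proof (cases "s = 0")
    case True
    then have "M *v v = 0" by (simp add: s_def)
    with assms obtain u where "norm u = 1" "transpose M *v u = 0"
      using left_kernel_nontrivial[of M v] by force
    then show ?thesis
      using \<open>M *v v = 0\<close> \<open>norm v = 1\<close> unfolding singular_value_def by auto
  next
    case False
    have weak: "(M *v v) \<bullet> (M *v h) = s\<^sup>2 * (v \<bullet> h)" for h
      using minimal_gain_first_variation[of s M v h] min \<open>norm v = 1\<close> by (simp add: s_def)
    have "transpose M *v (M *v v) = s\<^sup>2 *\<^sub>R v"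
    proof (rule vector_eq_rdot[THEN iffD1], rule allI)
      show "(transpose M *v (M *v v)) \<bullet> h = (s\<^sup>2 *\<^sub>R v) \<bullet> h" for h
        using weak[of h] by (simp add: dot_lmul_matrix flip: vector_transpose_matrix)
    qed
    then have "transpose M *v ((1 / s) *\<^sub>R (M *v v)) = s *\<^sub>R v"
      using False by (simp add: matrix_vector_mult_scaleR power2_eq_square)
    moreover have "norm ((1 / s) *\<^sub>R (M *v v)) = 1" "M *v v = s *\<^sub>R ((1 / s) *\<^sub>R (M *v v))"
      using False by (auto simp: s_def)
    ultimately show ?thesis
      using \<open>norm v = 1\<close> unfolding singular_value_def s_def[symmetric]
      by (metis norm_ge_zero s_def)
  qed
next
  fix t assume "singular_value M t"
  then show "norm (M *v v) \<le> t"
    unfolding singular_value_def using min by (metis abs_of_nonneg mult.right_neutral norm_scaleR)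
qed

lemma smallest_singular_value_attained:
  fixes M :: "real^'p^'q"
  assumes "CARD('p) \<le> CARD('q)"
  obtains v where "norm v = 1" and "norm (M *v v) = smallest_singular_value M"
  by (metis assms minimal_gain_exists[of M] smallest_singular_value_eq_minimal_gain)

lemma smallest_singular_value_le:
  fixes M :: "real^'p^'q"
  assumes "CARD('p) \<le> CARD('q)"
  shows "smallest_singular_value M * norm u \<le> norm (M *v u)"
  by (metis assms minimal_gain_exists[of M] smallest_singular_value_eq_minimal_gain)

lemma smallest_singular_value_nonneg:
  fixes M :: "real^'p^'q"
  assumes "CARD('p) \<le> CARD('q)"
  shows "0 \<le> smallest_singular_value M"
  by (metis assms norm_ge_zero smallest_singular_value_attained)

lemma smallest_singular_value_lipschitz:
  fixes M M' :: "real^'p^'q"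
  assumes "CARD('p) \<le> CARD('q)"
  shows "\<bar>smallest_singular_value M - smallest_singular_value M'\<bar> \<le> norm (M - M')"
proof -
  have one_sided: "smallest_singular_value X \<le> smallest_singular_value Y + norm (X - Y)"
    for X Y :: "real^'p^'q"
  proof -
    obtain v where v: "norm v = 1" "norm (Y *v v) = smallest_singular_value Y"
      using smallest_singular_value_attained[OF assms] by metis
    have "smallest_singular_value X \<le> norm (X *v v)"
      using smallest_singular_value_le[OF assms, of X v] v by simp
    also have "\<dots> = norm (Y *v v + (X - Y) *v v)"
      by (simp add: matrix_vector_mult_diff_rdistrib)
    also have "\<dots> \<le> norm (Y *v v) + norm (X - Y) * norm v"
      by (rule order_trans[OF norm_triangle_ineq add_left_mono[OF norm_matrix_vector_mult_le]])
    finally show ?thesis using v by simp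
  qed
  show ?thesis
    using one_sided[of M M'] one_sided[of M' M] by (simp add: norm_minus_commute)
qed

lemma tendsto_smallest_singular_value:
  fixes M :: "'a::topological_space \<Rightarrow> real^'p^'q"
  assumes "CARD('p) \<le> CARD('q)" and "(M \<longlongrightarrow> M0) F"
  shows "((\<lambda>y. smallest_singular_value (M y)) \<longlongrightarrow> smallest_singular_value M0) F"
proof -
  have "((\<lambda>y. norm (M y - M0)) \<longlongrightarrow> 0) F"
    using assms(2) by (simp add: LIM_zero tendsto_norm_zero)
  then have "((\<lambda>y. smallest_singular_value (M y) - smallest_singular_value M0) \<longlongrightarrow> 0) F"
    by (rule Lim_null_comparison[rotated])
      (simp add: smallest_singular_value_lipschitz[OF assms(1)])
  then show ?thesis by (rule LIM_zero_cancel)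
qed

section \<open>The unique TLS solution of generic data\<close>

text \<open>
  Splits a vector on which \<open>[A, b]\<close> acts into the part that meets \<open>A\<close> and the coefficient of \<open>b\<close>.
\<close>

definition append_entry :: "real^'n \<Rightarrow> real \<Rightarrow> real^('n option)" where
  "append_entry y c = (\<chi> j. case j of None \<Rightarrow> c | Some l \<Rightarrow> y $ l)"

lemma sum_UNIV_option:
  fixes f :: "'n::finite option \<Rightarrow> 'a::comm_monoid_add"
  shows "sum f UNIV = f None + (\<Sum>l\<in>UNIV. f (Some l))"
  by (simp add: UNIV_option_conv sum.reindex)

lemma append_entry_cases:
  obtains y c where "v = append_entry y c"
proof
  show "v = append_entry (\<chi> l. v $ Some l) (v $ None)"
    by (auto simp: append_entry_def vec_eq_iff split: option.split)
qed

lemma inner_append_entry: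
  "append_entry y c \<bullet> append_entry z d = y \<bullet> z + c * d"
  by (simp add: append_entry_def inner_vec_def sum_UNIV_option)

lemma augment_mult_append_entry:
  "augment A b *v append_entry y c = A *v y + c *\<^sub>R b"
  by (simp add: append_entry_def augment_def matrix_vector_mult_def vec_eq_iff sum_UNIV_option
      mult.commute)

lemma augment_diff:
  "augment A b - augment A' b' = augment (A - A') (b - b')"
  by (auto simp: augment_def vec_eq_iff split: option.split)

lemma norm_augment_power2:
  "(norm (augment A b))\<^sup>2 = (norm A)\<^sup>2 + (norm b)\<^sup>2"
proof -
  have "augment A b \<bullet> augment A b = A \<bullet> A + b \<bullet> b"
    by (simp add: augment_def inner_vec_def sum_UNIV_option sum.distrib)
  then show ?thesis by (simp add: dot_square_norm)
qed

lemma outer_product_nth: "outer_product u v $ i $ j = u $ i * v $ j"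
  by (simp add: outer_product_def matrix_matrix_mult_def columnvector_def rowvector_def)

lemma outer_product_mult: "outer_product u v *v y = (v \<bullet> y) *\<^sub>R u"
  by (simp add: outer_product_nth matrix_vector_mult_def vec_eq_iff inner_vec_def sum_distrib_left
      mult_ac)

lemma norm_outer_product: "norm (outer_product u v) = norm u * norm v"
proof -
  have "outer_product u v \<bullet> outer_product u v = (u \<bullet> u) * (v \<bullet> v)"
    unfolding inner_vec_def sum_product by (simp add: outer_product_nth mult_ac)
  then have "(norm (outer_product u v))\<^sup>2 = (norm u * norm v)\<^sup>2"
    by (simp add: dot_square_norm power_mult_distrib)
  then show ?thesis by simp
qed

lemma inner_transpose_mult:
  fixes A :: "real^'n^'m"
  shows "(transpose A *v u) \<bullet> y = u \<bullet> (A *v y)"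
  by (simp add: dot_lmul_matrix)

text \<open>
  If \<open>[A', b']\<close> is consistent then it kills \<open>(y, -1)\<close> for some \<open>y\<close>, so the distance to it
  is at least the gain of \<open>[A, b]\<close> per unit length of that vector.
\<close>

lemma gain_le_distance_to_consistent:
  assumes "A' *v y = b'"
  shows "norm (augment A b *v append_entry y (- 1))
    \<le> norm (augment A b - augment A' b') * norm (append_entry y (- 1))"
proof -
  have "augment A b *v append_entry y (- 1) = (augment A b - augment A' b') *v append_entry y (- 1)"
    using assms by (simp add: matrix_vector_mult_diff_rdistrib augment_mult_append_entry)
  then show ?thesis by (simp add: norm_matrix_vector_mult_le)
qed


text \<open>
  The smallest eigenvalue of \<open>A\<^sup>T A - \<sigma>\<^sup>2 I\<close>, where \<open>\<sigma>\<close> is the smallest singular value of \<open>[A, b]\<close>.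
\<close>

definition tls_gap :: "real^'n^'m \<Rightarrow> real^'m \<Rightarrow> real" where
  "tls_gap A b = (smallest_singular_value A)\<^sup>2 - (smallest_singular_value (augment A b))\<^sup>2"

lemma tls_generic_iff_gap:
  fixes A :: "real^'n^'m"
  assumes "CARD('n) < CARD('m)"
  shows "tls_generic A b \<longleftrightarrow> 0 < tls_gap A b"
proof -
  have "0 \<le> smallest_singular_value A" "0 \<le> smallest_singular_value (augment A b)"
    using assms by (auto intro: smallest_singular_value_nonneg)
  then show ?thesis
    unfolding tls_generic_def tls_gap_def diff_gt_0_iff_gt
    by (meson not_le power_mono power_strict_mono zero_less_numeral)
qed

lemma tls_gap_coercive:
  fixes A :: "real^'n^'m"
  assumes "CARD('n) < CARD('m)"
  shows "tls_gap A b * (norm y)\<^sup>2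
    \<le> (norm (A *v y))\<^sup>2 - (smallest_singular_value (augment A b))\<^sup>2 * (norm y)\<^sup>2"
proof -
  have "(smallest_singular_value A * norm y)\<^sup>2 \<le> (norm (A *v y))\<^sup>2"
    using assms by (intro power_mono smallest_singular_value_le mult_nonneg_nonneg
        smallest_singular_value_nonneg) auto
  then show ?thesis by (simp add: tls_gap_def algebra_simps power_mult_distrib)
qed

text \<open>
  Eckart--Young for one singular value: with a unit vector \<open>v\<close> of minimal gain, subtracting the
  rank-one matrix \<open>C v v\<^sup>T\<close> from \<open>C = [A, b]\<close> costs exactly the smallest singular value. Genericity
  makes the last entry of \<open>v\<close> nonzero, and then the corrected system is consistent.
\<close>

lemma tls_optimal_correction:
  fixes A :: "real^'n^'m"
  assumes "CARD('n) < CARD('m)" and "tls_generic A b"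
  obtains A' y where "norm (augment A b - augment A' (A' *v y)) = smallest_singular_value (augment A b)"
proof -
  let ?s = "smallest_singular_value (augment A b)"
  have size: "CARD('n) \<le> CARD('m)" "CARD('n option) \<le> CARD('m)"
    using assms(1) by auto
  obtain v where v: "norm v = 1" "norm (augment A b *v v) = ?s"
    using smallest_singular_value_attained[OF size(2)] by blast
  obtain y c where v_eq: "v = append_entry y c" by (rule append_entry_cases)
  define u where "u = augment A b *v v"
  have unit: "(norm y)\<^sup>2 + c\<^sup>2 = 1"
    using v(1) inner_append_entry[of y c y c]
    by (simp add: v_eq dot_square_norm power2_eq_square flip: norm_eq_1)
  have u_eq: "u = A *v y + c *\<^sub>R b"
    by (simp add: u_def v_eq augment_mult_append_entry)
  have "c \<noteq> 0"
  proof
    assume "c = 0"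
    then have "norm y = 1" using unit norm_ge_zero[of y] by (simp add: power2_eq_1_iff)
    then have "smallest_singular_value A \<le> norm u"
      using smallest_singular_value_le[OF size(1), of A y] \<open>c = 0\<close> by (simp add: u_eq)
    then show False
      using assms(2) v(2) by (simp add: u_def tls_generic_def)
  qed
  define A' where "A' = A - outer_product u y"
  define b' where "b' = b - c *\<^sub>R u"
  have "A' *v y + c *\<^sub>R b' = u - ((norm y)\<^sup>2 + c\<^sup>2) *\<^sub>R u"
    by (simp add: A'_def b'_def u_eq matrix_vector_mult_diff_rdistrib outer_product_mult
        dot_square_norm algebra_simps power2_eq_square)
  then have "c *\<^sub>R b' = - (A' *v y)"
    using unit by (simp add: eq_neg_iff_add_eq_0 add.commute)
  then have "b' = (1 / c) *\<^sub>R - (A' *v y)"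
    using \<open>c \<noteq> 0\<close> by (metis divide_self_if scaleR_one scaleR_scaleR times_divide_eq_left mult_1)
  then have b': "b' = A' *v ((- 1 / c) *\<^sub>R y)"
    by (simp only: matrix_vector_mult_scaleR) simp
  have "(norm (augment A b - augment A' b'))\<^sup>2 = (norm u)\<^sup>2 * ((norm y)\<^sup>2 + c\<^sup>2)"
    by (simp add: augment_diff norm_augment_power2 A'_def b'_def norm_outer_product
        power_mult_distrib algebra_simps)
  also have "\<dots> = ?s\<^sup>2"
    using unit v(2) by (simp add: u_def)
  finally have "norm (augment A b - augment A' b') = ?s"
    using smallest_singular_value_nonneg[OF size(2), of "augment A b"] by (simp add: power2_eq_iff_nonneg)
  then show ?thesis using that b' by blast
qed

text \<open>
  The minimal distance to a consistent system is at most the smallest singular value of \<open>[A, b]\<close>, so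
  a solution \<open>x\<close> makes \<open>(x, -1)\<close> a vector of minimal gain. The equation is that of the corresponding
  right singular vector, tested against \<open>(y, c)\<close>: for \<open>c = 0\<close> it contains the normal equation, and
  the remaining direction determines the singular value itself.
\<close>

lemma tls_solution_weak_equation:
  fixes A :: "real^'n^'m"
  assumes size: "CARD('n) < CARD('m)" and gen: "tls_generic A b" and x: "is_tls_solution A b x"
  shows "(A *v x - b) \<bullet> (A *v y + c *\<^sub>R b) = (smallest_singular_value (augment A b))\<^sup>2 * (x \<bullet> y - c)"
proof -
  let ?s = "smallest_singular_value (augment A b)"
  have size': "CARD('n option) \<le> CARD('m)" using size by simp
  obtain A' b' where min: "tls_minimizer A b A' b'" and "A' *v x = b'"
    using x by (auto simp: is_tls_solution_def)
  obtain A'' z where "norm (augment A b - augment A'' (A'' *v z)) = ?s"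
    using tls_optimal_correction[OF size gen] by blast
  then have "norm (augment A b - augment A' b') \<le> ?s"
    using min unfolding tls_minimizer_def tls_feasible_def by (metis rangeI)
  then have "norm (augment A b *v append_entry x (- 1)) \<le> ?s * norm (append_entry x (- 1))"
    using gain_le_distance_to_consistent[OF \<open>A' *v x = b'\<close>, of A b]
    by (meson mult_right_mono norm_ge_zero order_trans)
  then have "(augment A b *v append_entry x (- 1)) \<bullet> (augment A b *v append_entry y c)
      = ?s\<^sup>2 * (append_entry x (- 1) \<bullet> append_entry y c)"
    using size' by (intro minimal_gain_first_variation smallest_singular_value_le
        smallest_singular_value_nonneg) auto
  then show ?thesis
    by (simp add: augment_mult_append_entry inner_append_entry)
qed

text \<open>
  The difference of \<open>(x, -1)\<close> and \<open>(z, -1)\<close> has last entry 0, so for \<open>x \<noteq> z\<close> the matrix \<open>A\<close> alone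
  would attain the smallest singular value of \<open>[A, b]\<close> as a gain, against genericity.
\<close>

lemma is_tls_solution_unique:
  fixes A :: "real^'n^'m"
  assumes size: "CARD('n) < CARD('m)" and gen: "tls_generic A b"
    and x: "is_tls_solution A b x" and z: "is_tls_solution A b z"
  shows "x = z"
proof -
  let ?s = "smallest_singular_value (augment A b)"
  have "(A *v (x - z)) \<bullet> (A *v (x - z)) = ?s\<^sup>2 * ((x - z) \<bullet> (x - z))"
    using tls_solution_weak_equation[OF size gen x, of "x - z" 0]
      tls_solution_weak_equation[OF size gen z, of "x - z" 0]
    by (simp add: matrix_vector_mult_diff_distrib inner_diff_left right_diff_distrib)
  then have "tls_gap A b * (norm (x - z))\<^sup>2 \<le> 0"
    using tls_gap_coercive[OF size, of A b "x - z"] by (simp add: dot_square_norm)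
  then show ?thesis
    using gen by (simp add: tls_generic_iff_gap[OF size] mult_le_0_iff)
qed

lemma is_tls_solution_exists:
  fixes A :: "real^'n^'m"
  assumes size: "CARD('n) < CARD('m)" and gen: "tls_generic A b"
  shows "\<exists>x. is_tls_solution A b x"
proof -
  let ?s = "smallest_singular_value (augment A b)"
  have size': "CARD('n option) \<le> CARD('m)" using size by simp
  obtain A' y where dist: "norm (augment A b - augment A' (A' *v y)) = ?s"
    using tls_optimal_correction[OF size gen] by blast
  have "?s \<le> norm (augment A b - augment A'' b'')" if consistent: "tls_feasible A'' b''" for A'' b''
  proof -
    obtain z where z: "A'' *v z = b''"
      using consistent by (auto simp: tls_feasible_def)
    have "append_entry z (- 1) \<bullet> append_entry z (- 1) \<noteq> 0"
      using inner_ge_zero[of z] unfolding inner_append_entry by linarith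
    then have "0 < norm (append_entry z (- 1))" by auto
    moreover have "?s * norm (append_entry z (- 1)) \<le> norm (augment A b - augment A'' b'') * norm (append_entry z (- 1))"
      using smallest_singular_value_le[OF size'] gain_le_distance_to_consistent[OF z]
      by (rule order_trans)
    ultimately show ?thesis by simp
  qed
  then have "tls_minimizer A b A' (A' *v y)"
    using dist by (auto simp: tls_minimizer_def tls_feasible_def)
  then show ?thesis
    by (auto simp: is_tls_solution_def)
qed

lemma tls_solution_equation:
  fixes A :: "real^'n^'m"
  assumes size: "CARD('n) < CARD('m)" and gen: "tls_generic A b"
  shows "(A *v tls_solution A b - b) \<bullet> (A *v y + c *\<^sub>R b)
    = (smallest_singular_value (augment A b))\<^sup>2 * (tls_solution A b \<bullet> y - c)"
proof -
  have "is_tls_solution A b (tls_solution A b)"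
    unfolding tls_solution_def
    using is_tls_solution_exists[OF assms] is_tls_solution_unique[OF assms] by (metis theI)
  then show ?thesis by (rule tls_solution_weak_equation[OF assms])
qed

lemma tls_normal_equation:
  fixes A :: "real^'n^'m"
  assumes size: "CARD('n) < CARD('m)" and gen: "tls_generic A b"
  shows "transpose A *v (A *v tls_solution A b - b)
    = (smallest_singular_value (augment A b))\<^sup>2 *\<^sub>R tls_solution A b"
proof (rule vector_eq_rdot[THEN iffD1], rule allI)
  fix y
  show "(transpose A *v (A *v tls_solution A b - b)) \<bullet> y
      = ((smallest_singular_value (augment A b))\<^sup>2 *\<^sub>R tls_solution A b) \<bullet> y"
    using tls_solution_equation[OF assms, of y 0] by (simp add: dot_lmul_matrix)
qed

text \<open>
  Coercivity of \<open>A\<^sup>T A - \<sigma>\<^sup>2 I\<close> turns the residual of \<open>z\<close> in the normal equation into an error.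
  The bound is meant for the solution \<open>z\<close> of nearby data, whose residual is small.
\<close>

lemma tls_solution_error_bound:
  fixes A :: "real^'n^'m"
  assumes size: "CARD('n) < CARD('m)" and gen: "tls_generic A b"
  shows "tls_gap A b * norm (tls_solution A b - z)
    \<le> norm (transpose A *v (b - A *v z) + (smallest_singular_value (augment A b))\<^sup>2 *\<^sub>R z)"
    (is "_ \<le> norm ?residual")
proof (cases "tls_solution A b = z")
  case False
  let ?s = "smallest_singular_value (augment A b)" and ?y = "tls_solution A b - z"
  have "transpose A *v (A *v ?y) - ?s\<^sup>2 *\<^sub>R ?y = ?residual"
    using tls_normal_equation[OF assms]
    by (simp add: matrix_vector_mult_diff_distrib algebra_simps)
  then have "(A *v ?y) \<bullet> (A *v ?y) - ?s\<^sup>2 * (?y \<bullet> ?y) = ?residual \<bullet> ?y"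
    by (metis inner_diff_left inner_scaleR_left inner_transpose_mult)
  also have "\<dots> \<le> norm ?residual * norm ?y"
    by (rule norm_cauchy_schwarz)
  finally have "tls_gap A b * (norm ?y)\<^sup>2 \<le> norm ?residual * norm ?y"
    using tls_gap_coercive[OF size, of A b ?y] by (simp add: dot_square_norm)
  then show ?thesis
    using False by (simp add: power2_eq_square mult_le_cancel_right flip: mult.assoc)
qed simp

section \<open>Differentiability of the solution\<close>

text \<open>
  A product whose first factor vanishes at \<open>a\<close> is differentiable there as soon as the first factor
  is differentiable and the second one merely continuous. This is what turns an exact increment
  formula involving the perturbed solution into a derivative.
\<close>

lemma (in bounded_bilinear) has_derivative_vanishing_left:
  assumes g: "(g has_derivative g') (at x)" and "g x = 0" and \<phi>: "isCont \<phi> x"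
  shows "((\<lambda>y. prod (g y) (\<phi> y)) has_derivative (\<lambda>h. prod (g' h) (\<phi> x))) (at x)"
proof -
  have "((\<lambda>y. prod (g y) (\<phi> y - \<phi> x)) has_derivative (\<lambda>h. 0)) (at x)"
    unfolding has_derivative_iff_norm
  proof
    obtain K where K: "\<And>a b. norm (prod a b) \<le> norm a * norm b * K" "0 \<le> K"
      using nonneg_bounded by blast
    obtain B where B: "\<And>h. norm (g' h) \<le> norm h * B"
      using bounded_linear.bounded[OF has_derivative_bounded_linear[OF g]] by blast
    define \<rho> where "\<rho> y = norm (g y - g x - g' (y - x)) / norm (y - x)" for y
    have "(\<rho> \<longlongrightarrow> 0) (at x)"
      using g unfolding has_derivative_iff_norm \<rho>_def by blast
    moreover have "((\<lambda>y. norm (\<phi> y - \<phi> x)) \<longlongrightarrow> 0) (at x)"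
      using \<phi> by (simp add: isCont_def LIM_zero tendsto_norm_zero)
    ultimately have lim: "((\<lambda>y. (\<rho> y + B) * norm (\<phi> y - \<phi> x) * K) \<longlongrightarrow> (0 + B) * 0 * K) (at x)"
      by (intro tendsto_intros)
    have "norm (norm (prod (g y) (\<phi> y - \<phi> x)) / norm (y - x)) \<le> (\<rho> y + B) * norm (\<phi> y - \<phi> x) * K"
      if "y \<noteq> x" for y
    proof -
      have "norm (g y) \<le> norm (g y - g x - g' (y - x)) + norm (g' (y - x))"
        using norm_triangle_ineq[of "g y - g x - g' (y - x)" "g' (y - x)"] \<open>g x = 0\<close> by simp
      also have "\<dots> \<le> (\<rho> y + B) * norm (y - x)"
        using that B[of "y - x"] by (simp add: \<rho>_def field_simps)
      finally have "norm (g y) / norm (y - x) \<le> \<rho> y + B"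
        using that by (simp add: field_simps)
      then have "norm (g y) / norm (y - x) * (norm (\<phi> y - \<phi> x) * K) \<le> (\<rho> y + B) * (norm (\<phi> y - \<phi> x) * K)"
        using K(2) by (intro mult_right_mono) auto
      moreover have "norm (prod (g y) (\<phi> y - \<phi> x)) / norm (y - x)
          \<le> norm (g y) * norm (\<phi> y - \<phi> x) * K / norm (y - x)"
        by (intro divide_right_mono K) auto
      ultimately show ?thesis by (simp add: mult_ac)
    qed
    then have "\<forall>\<^sub>F y in at x. norm (norm (prod (g y) (\<phi> y - \<phi> x)) / norm (y - x))
        \<le> (\<rho> y + B) * norm (\<phi> y - \<phi> x) * K"
      by (auto simp: eventually_at_filter)
    from Lim_null_comparison[OF this] lim
    show "((\<lambda>y. norm (prod (g y) (\<phi> y - \<phi> x) - prod (g x) (\<phi> x - \<phi> x) - 0) / norm (y - x)) \<longlongrightarrow> 0) (at x)"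
      by (simp add: zero_right)
  qed simp
  moreover have "((\<lambda>y. prod (g y) (\<phi> x)) has_derivative (\<lambda>h. prod (g' h) (\<phi> x))) (at x)"
    by (rule bounded_linear.has_derivative[OF bounded_linear_left g])
  ultimately show ?thesis
    using has_derivative_add by (fastforce simp: diff_right)
qed

lemma bounded_bilinear_matrix_vector_mult:
  "bounded_bilinear ((*v) :: real^'n^'m \<Rightarrow> real^'n \<Rightarrow> real^'m)"
proof
  show "\<exists>K. \<forall>(M :: real^'n^'m) v. norm (M *v v) \<le> norm M * norm v * K"
    by (metis norm_matrix_vector_mult_le mult.right_neutral)
qed (simp_all add: matrix_vector_mult_add_rdistrib matrix_vector_right_distrib
    scaleR_matrix_vector_assoc matrix_vector_mult_scaleR)

lemma bounded_linear_transpose: "bounded_linear (transpose :: real^'n^'m \<Rightarrow> real^'m^'n)"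
  by (rule linear_conv_bounded_linear[THEN iffD1], rule linearI)
    (simp_all add: transpose_def vec_eq_iff)

lemma tendsto_augment:
  assumes "(f \<longlongrightarrow> A) F" and "(g \<longlongrightarrow> b) F"
  shows "((\<lambda>y. augment (f y) (g y)) \<longlongrightarrow> augment A b) F"
  unfolding augment_def using assms
  by (intro tendsto_vec_lambda) (auto split: option.split intro!: tendsto_intros)

lemma tendsto_fst_at: "(fst \<longlongrightarrow> a) (at (a, b))"
  and tendsto_snd_at: "(snd \<longlongrightarrow> b) (at (a, b))"
  using tendsto_fst[OF tendsto_ident_at, of "(a, b)" UNIV]
    tendsto_snd[OF tendsto_ident_at, of "(a, b)" UNIV] by simp_all

lemma smallest_singular_value_augment_tendsto:
  fixes A :: "real^'n^'m"
  assumes "CARD('n) < CARD('m)"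
  shows "((\<lambda>D. smallest_singular_value (augment (fst D) (snd D))) \<longlongrightarrow>
    smallest_singular_value (augment A b)) (at (A, b))"
  using assms
  by (intro tendsto_smallest_singular_value tendsto_augment tendsto_fst_at tendsto_snd_at) simp

lemma tls_gap_tendsto:
  fixes A :: "real^'n^'m"
  assumes "CARD('n) < CARD('m)"
  shows "((\<lambda>D. tls_gap (fst D) (snd D)) \<longlongrightarrow> tls_gap A b) (at (A, b))"
  unfolding tls_gap_def using assms
  by (intro tendsto_intros smallest_singular_value_augment_tendsto
      tendsto_smallest_singular_value tendsto_fst_at) simp

lemma eventually_tls_generic:
  fixes A :: "real^'n^'m"
  assumes size: "CARD('n) < CARD('m)" and gen: "tls_generic A b"
  shows "\<forall>\<^sub>F D in at (A, b). tls_generic (fst D) (snd D)"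
  using order_tendstoD(1)[OF tls_gap_tendsto[OF size]] gen
  by (simp add: tls_generic_iff_gap[OF size])

text \<open>
  In the error bound for the perturbed data take the unperturbed solution as \<open>z\<close>. Its residual is
  a continuous function of the data that vanishes at \<open>(A, b)\<close>, and the gap stays away from 0.
\<close>

lemma tls_solution_tendsto:
  fixes A :: "real^'n^'m"
  assumes size: "CARD('n) < CARD('m)" and gen: "tls_generic A b"
  shows "((\<lambda>D. tls_solution (fst D) (snd D)) \<longlongrightarrow> tls_solution A b) (at (A, b))"
proof -
  let ?x = "tls_solution A b" and ?X = "\<lambda>D. tls_solution (fst D) (snd D)"
  let ?S = "\<lambda>D. (smallest_singular_value (augment (fst D) (snd D)))\<^sup>2"
  define res where "res D = transpose (fst D) *v (snd D - fst D *v ?x) + ?S D *\<^sub>R ?x"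
    for D :: "(real^'n^'m) \<times> (real^'m)"
  have "(res \<longlongrightarrow> transpose A *v (b - A *v ?x) + (smallest_singular_value (augment A b))\<^sup>2 *\<^sub>R ?x)
      (at (A, b))"
    unfolding res_def
    by (intro tendsto_intros bounded_bilinear.tendsto[OF bounded_bilinear_matrix_vector_mult]
        bounded_linear.tendsto[OF bounded_linear_transpose] tendsto_fst_at tendsto_snd_at
        smallest_singular_value_augment_tendsto[OF size])
  moreover have "transpose A *v (b - A *v ?x) + (smallest_singular_value (augment A b))\<^sup>2 *\<^sub>R ?x = 0"
    using tls_normal_equation[OF assms] by (simp add: vector_matrix_mult_diff_distrib algebra_simps)
  ultimately have "((\<lambda>D. norm (res D) / tls_gap (fst D) (snd D)) \<longlongrightarrow> norm (0 :: real^'n) / tls_gap A b) (at (A, b))"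
    using gen tls_gap_tendsto[OF size, of A b]
    by (intro tendsto_intros) (auto simp: tls_generic_iff_gap[OF size])
  then have "((\<lambda>D. norm (res D) / tls_gap (fst D) (snd D)) \<longlongrightarrow> 0) (at (A, b))"
    by simp
  moreover have "\<forall>\<^sub>F D in at (A, b). norm (?X D - ?x) \<le> norm (res D) / tls_gap (fst D) (snd D)"
    using eventually_tls_generic[OF assms]
  proof eventually_elim
    case (elim D)
    then have "0 < tls_gap (fst D) (snd D)" by (simp add: tls_generic_iff_gap[OF size])
    then show ?case
      using tls_solution_error_bound[OF size elim, of ?x]
      by (simp add: res_def pos_le_divide_eq mult.commute)
  qed
  ultimately have "((\<lambda>D. ?X D - ?x) \<longlongrightarrow> 0) (at (A, b))"
    by (rule Lim_null_comparison[rotated])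
  then show ?thesis by (rule LIM_zero_cancel)
qed

text \<open>
  An identity, not an expansion. The change of \<open>\<sigma>\<^sup>2\<close> comes from testing the equation of either
  solution with the other one, which gives \<open>(\<sigma>'\<^sup>2 - \<sigma>\<^sup>2)(1 + x \<bullet> x')\<close> in terms of the data. Every
  summand is the increment of the data times a factor that depends continuously on
  \<open>x'\<close> and the perturbed data.
\<close>

lemma tls_solution_increment:
  fixes A A' :: "real^'n^'m"
  assumes size: "CARD('n) < CARD('m)" and gen: "tls_generic A b" and gen': "tls_generic A' b'"
  defines "x \<equiv> tls_solution A b" and "x' \<equiv> tls_solution A' b'"
  defines "r \<equiv> b - A *v x" and "r' \<equiv> b' - A' *v x'"
  assumes denom: "1 + x \<bullet> x' \<noteq> 0"
  shows "(transpose A ** A - (smallest_singular_value (augment A b))\<^sup>2 *\<^sub>R mat 1) *v (x' - x)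
    = transpose (A' - A) *v r' + transpose A *v ((b' - b) - (A' - A) *v x')
      + (((b' - b) - (A' - A) *v x) \<bullet> r' + ((b' - b) - (A' - A) *v x') \<bullet> r)
        *\<^sub>R ((1 / (1 + x \<bullet> x')) *\<^sub>R x')"
proof -
  define \<sigma> \<sigma>' where "\<sigma> = smallest_singular_value (augment A b)"
    and "\<sigma>' = smallest_singular_value (augment A' b')"
  have "(A *v x - b) \<bullet> (A *v x' - b) = \<sigma>\<^sup>2 * (x \<bullet> x' + 1)"
    using tls_solution_equation[OF size gen, of x' "-1"] by (simp add: \<sigma>_def x_def)
  moreover have "(A' *v x' - b') \<bullet> (A' *v x - b') = \<sigma>'\<^sup>2 * (x' \<bullet> x + 1)"
    using tls_solution_equation[OF size gen', of x "-1"] by (simp add: \<sigma>'_def x'_def)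
  ultimately have "((b' - b) - (A' - A) *v x) \<bullet> r' + ((b' - b) - (A' - A) *v x') \<bullet> r
      = (\<sigma>'\<^sup>2 - \<sigma>\<^sup>2) * (1 + x \<bullet> x')"
    by (simp add: r_def r'_def matrix_vector_mult_diff_rdistrib inner_diff_left inner_diff_right
        inner_commute algebra_simps)
  then have \<sigma>_diff: "(((b' - b) - (A' - A) *v x) \<bullet> r' + ((b' - b) - (A' - A) *v x') \<bullet> r)
        *\<^sub>R ((1 / (1 + x \<bullet> x')) *\<^sub>R x') = (\<sigma>'\<^sup>2 - \<sigma>\<^sup>2) *\<^sub>R x'"
    using denom by simp
  have normal: "transpose A *v (A *v x) - transpose A *v b = \<sigma>\<^sup>2 *\<^sub>R x"
    using tls_normal_equation[OF size gen]
    by (simp add: \<sigma>_def x_def matrix_vector_mult_diff_distrib vector_matrix_mult_diff_distrib)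
  have normal': "transpose A' *v (A' *v x') - transpose A' *v b' = \<sigma>'\<^sup>2 *\<^sub>R x'"
    using tls_normal_equation[OF size gen']
    by (simp add: \<sigma>'_def x'_def matrix_vector_mult_diff_distrib vector_matrix_mult_diff_distrib)
  have P: "(transpose A ** A - \<sigma>\<^sup>2 *\<^sub>R mat 1) *v (x' - x)
      = transpose A *v (A *v x') - \<sigma>\<^sup>2 *\<^sub>R x' - (transpose A *v (A *v x) - \<sigma>\<^sup>2 *\<^sub>R x)"
    by (simp add: matrix_vector_mult_diff_rdistrib matrix_vector_mult_diff_distrib
        matrix_vector_mul_assoc del: transpose_matrix_vector flip: scaleR_matrix_vector_assoc)
  have tr: "transpose (A' - A) = transpose A' - transpose A"
    by (simp add: transpose_def vec_eq_iff)
  show ?thesis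
    unfolding \<sigma>_diff \<sigma>_def[symmetric] P tr using normal normal'
    by (simp add: r'_def matrix_vector_mult_diff_rdistrib matrix_vector_mult_diff_distrib
        algebra_simps del: transpose_matrix_vector)
qed

lemma matrix_inv_mult_left:
  fixes P :: "real^'n^'n"
  assumes "invertible P"
  shows "matrix_inv P ** P = mat 1"
  using assms someI_ex[of "\<lambda>Q. P ** Q = mat 1 \<and> Q ** P = mat 1"]
  unfolding invertible_def matrix_inv_def by blast

lemma tls_matrix_invertible:
  fixes A :: "real^'n^'m"
  assumes size: "CARD('n) < CARD('m)" and gen: "tls_generic A b"
  shows "invertible (transpose A ** A - (smallest_singular_value (augment A b))\<^sup>2 *\<^sub>R mat 1)"
    (is "invertible ?P")
proof -
  have "y = 0" if "?P *v y = 0" for y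
  proof -
    have "(?P *v y) \<bullet> y = (A *v y) \<bullet> (A *v y) - (smallest_singular_value (augment A b))\<^sup>2 * (y \<bullet> y)"
      by (simp add: matrix_vector_mult_diff_rdistrib inner_diff_left inner_transpose_mult
          del: transpose_matrix_vector flip: matrix_vector_mul_assoc scaleR_matrix_vector_assoc)
    then have "tls_gap A b * (norm y)\<^sup>2 \<le> 0"
      using that tls_gap_coercive[OF size, of A b y] by (simp add: dot_square_norm)
    then show ?thesis
      using gen by (simp add: tls_generic_iff_gap[OF size] mult_le_0_iff)
  qed
  then show ?thesis
    by (metis invertible_left_inverse matrix_left_invertible_ker)
qed

text \<open>
  In the increment formula every summand vanishes with the data increment in one factor, so the
  continuous factors may be frozen at \<open>(A, b)\<close>. There the two inner products in the formula
  coincide; this is the origin of the factor 2.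
\<close>

theorem tls_solution_has_derivative:
  fixes A :: "real^'n^'m" and b r :: "real^'m" and x :: "real^'n" and P :: "real^'n^'n"
  assumes size: "CARD('n) < CARD('m)" and gen: "tls_generic A b"
    and x: "x = tls_solution A b" and r: "r = b - A *v x"
    and P: "P = transpose A ** A - (smallest_singular_value (augment A b))\<^sup>2 *\<^sub>R mat 1"
  shows "((\<lambda>D. tls_solution (fst D) (snd D)) has_derivative
      (\<lambda>h. matrix_inv P *v (transpose (fst h) *v r
         + (transpose A + (2 / (1 + x \<bullet> x)) *\<^sub>R outer_product x r) *v (snd h - fst h *v x))))
    (at (A, b))"
proof -
  define X where "X D = tls_solution (fst D) (snd D)" for D :: "(real^'n^'m) \<times> (real^'m)"
  have X0: "X (A, b) = x" by (simp add: X_def x)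
  have X_lim: "(X \<longlongrightarrow> x) (at (A, b))"
    unfolding X_def x by (rule tls_solution_tendsto[OF assms(1,2)])
  have X_cont: "isCont X (A, b)"
    using X_lim by (simp add: isCont_def X0)
  have "0 < 1 + x \<bullet> x" by (simp add: add_pos_nonneg)
  note mv = bounded_bilinear_matrix_vector_mult
  define e where "e D z = (snd D - b) - (fst D - A) *v z" for D and z :: "real^'n"
  define R where "R D = snd D - fst D *v X D" for D
  have R_cont: "isCont R (A, b)"
    unfolding R_def
    by (intro continuous_intros bounded_bilinear.continuous[OF mv] X_cont)
  have R0: "R (A, b) = r" by (simp add: R_def X0 r)
  have e_deriv: "((\<lambda>D. e D (z D)) has_derivative (\<lambda>h. snd h - fst h *v z (A, b))) (at (A, b))"
    if "isCont z (A, b)" for z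
    unfolding e_def
    by (intro has_derivative_diff bounded_bilinear.has_derivative_vanishing_left[OF mv] that)
      (auto intro!: derivative_eq_intros)
  have e0: "e (A, b) z = 0" for z by (simp add: e_def)
  define T where "T D = transpose (fst D - A) *v R D + transpose A *v e D (X D)
      + (e D x \<bullet> R D + e D (X D) \<bullet> r) *\<^sub>R ((1 / (1 + x \<bullet> X D)) *\<^sub>R X D)" for D
  have "((\<lambda>D. transpose (fst D - A) *v R D) has_derivative (\<lambda>h. transpose (fst h) *v R (A, b))) (at (A, b))"
  proof (rule bounded_bilinear.has_derivative_vanishing_left[OF mv _ _ R_cont])
    show "((\<lambda>D. transpose (fst D - A)) has_derivative (\<lambda>h. transpose (fst h))) (at (A, b))"
      by (rule bounded_linear.has_derivative[OF bounded_linear_transpose])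
        (auto intro!: derivative_eq_intros)
  qed (simp add: transpose_def vec_eq_iff)
  moreover have "((\<lambda>D. transpose A *v e D (X D)) has_derivative
      (\<lambda>h. transpose A *v (snd h - fst h *v X (A, b)))) (at (A, b))"
    by (intro bounded_linear.has_derivative[OF bounded_bilinear.bounded_linear_right[OF mv]]
        e_deriv X_cont)
  moreover have "((\<lambda>D. (e D x \<bullet> R D + e D (X D) \<bullet> r) *\<^sub>R ((1 / (1 + x \<bullet> X D)) *\<^sub>R X D)) has_derivative
      (\<lambda>h. ((snd h - fst h *v x) \<bullet> R (A, b) + (snd h - fst h *v X (A, b)) \<bullet> r)
        *\<^sub>R ((1 / (1 + x \<bullet> X (A, b))) *\<^sub>R X (A, b)))) (at (A, b))"
    using \<open>0 < 1 + x \<bullet> x\<close>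
    by (intro bounded_bilinear.has_derivative_vanishing_left[OF bounded_bilinear_scaleR]
        bounded_bilinear.has_derivative_vanishing_left[OF bounded_bilinear_inner]
        has_derivative_add has_derivative_inner_left e_deriv R_cont X_cont continuous_intros)
      (auto simp: e0 X0)
  ultimately have T_deriv: "(T has_derivative (\<lambda>h. transpose (fst h) *v r
      + transpose A *v (snd h - fst h *v x)
      + ((snd h - fst h *v x) \<bullet> r + (snd h - fst h *v x) \<bullet> r) *\<^sub>R ((1 / (1 + x \<bullet> x)) *\<^sub>R x))) (at (A, b))"
    unfolding T_def X0 R0 by (intro has_derivative_add)
  have regroup: "transpose (fst h) *v r + transpose A *v (snd h - fst h *v x)
      + ((snd h - fst h *v x) \<bullet> r + (snd h - fst h *v x) \<bullet> r) *\<^sub>R ((1 / (1 + x \<bullet> x)) *\<^sub>R x)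
    = transpose (fst h) *v r
      + (transpose A + (2 / (1 + x \<bullet> x)) *\<^sub>R outer_product x r) *v (snd h - fst h *v x)" for h
    by (simp add: matrix_vector_mult_add_rdistrib outer_product_mult inner_commute add.assoc
        del: transpose_matrix_vector flip: scaleR_matrix_vector_assoc)
  have inverse: "matrix_inv P ** P = mat 1"
    unfolding P by (rule matrix_inv_mult_left[OF tls_matrix_invertible[OF size gen]])
  have "((\<lambda>D. x + matrix_inv P *v T D) has_derivative (\<lambda>h. matrix_inv P *v (transpose (fst h) *v r
      + (transpose A + (2 / (1 + x \<bullet> x)) *\<^sub>R outer_product x r) *v (snd h - fst h *v x)))) (at (A, b))"
    using has_derivative_add[OF has_derivative_const[of x]
        bounded_linear.has_derivative[OF bounded_bilinear.bounded_linear_right[OF mv] T_deriv[unfolded regroup]]]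
    by simp
  moreover have "\<forall>\<^sub>F D in at (A, b). x + matrix_inv P *v T D = X D"
  proof -
    have "((\<lambda>D. 1 + x \<bullet> X D) \<longlongrightarrow> 1 + x \<bullet> x) (at (A, b))"
      by (intro tendsto_intros X_lim)
    then have "\<forall>\<^sub>F D in at (A, b). 0 < 1 + x \<bullet> X D"
      using \<open>0 < 1 + x \<bullet> x\<close> by (rule order_tendstoD)
    with eventually_tls_generic[OF size gen] show ?thesis
    proof eventually_elim
      case (elim D)
      from elim(2) have denom: "1 + tls_solution A b \<bullet> tls_solution (fst D) (snd D) \<noteq> 0"
        by (simp add: X_def x)
      have "P *v (X D - x) = T D"
        unfolding T_def P X_def R_def e_def r x
        by (rule tls_solution_increment[OF size gen elim(1) denom])
      then have "matrix_inv P *v T D = (matrix_inv P ** P) *v (X D - x)"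
        by (simp only: matrix_vector_mul_assoc[symmetric])
      then show ?case unfolding inverse by simp
    qed
  qed
  moreover have "x + matrix_inv P *v T (A, b) = X (A, b)"
    by (simp add: T_def X0 e0)
  ultimately show ?thesis
    unfolding X_def[symmetric] by (rule has_derivative_transform_eventually) simp
qed

section \<open>The maximal componentwise amplification\<close>

lemma diag_mult_vec: "diag y *v u = (\<chi> i. y $ i * u $ i)"
  by (simp add: diag_def matrix_vector_mult_def vec_eq_iff if_distrib[of "\<lambda>t. t * _"] cong: if_cong)

lemma diag_mult_diag: "diag y ** diag z = diag (\<chi> i. y $ i * z $ i)"
  by (simp add: diag_def matrix_matrix_mult_def vec_eq_iff if_distrib[of "\<lambda>t. t * _"] cong: if_cong)

lemma transpose_diag: "transpose (diag y) = diag y"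
  by (simp add: transpose_def diag_def vec_eq_iff)

text \<open>
  Penrose's argument: the symmetric idempotents \<open>M ** X\<close> and \<open>M ** Y\<close> absorb each other on opposite
  sides, so transposing a product of the two identifies them; likewise on the other side.
\<close>

lemma moore_penrose_unique:
  assumes X: "moore_penrose M X" and Y: "moore_penrose M Y"
  shows "X = Y"
proof -
  have "M ** X = M ** Y"
  proof -
    have "M ** X = transpose (M ** X)" using X by (simp add: moore_penrose_def)
    also have "\<dots> = transpose ((M ** Y) ** (M ** X))"
      using Y by (metis matrix_mul_assoc moore_penrose_def)
    also have "\<dots> = (M ** X) ** (M ** Y)"
      using X Y by (metis matrix_transpose_mul moore_penrose_def)
    also have "\<dots> = M ** Y" using X by (metis matrix_mul_assoc moore_penrose_def)
    finally show ?thesis .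
  qed
  moreover have "X ** M = Y ** M"
  proof -
    have "X ** M = transpose (X ** M)" using X by (simp add: moore_penrose_def)
    also have "\<dots> = transpose ((X ** M) ** (Y ** M))"
      using Y by (metis matrix_mul_assoc moore_penrose_def)
    also have "\<dots> = (Y ** M) ** (X ** M)"
      using X Y by (metis matrix_transpose_mul moore_penrose_def)
    also have "\<dots> = Y ** M" using X by (metis matrix_mul_assoc moore_penrose_def)
    finally show ?thesis .
  qed
  ultimately show ?thesis
    using X Y by (metis matrix_mul_assoc moore_penrose_def)
qed

text \<open>Since the inverse of 0 is 0, \<^const>\<open>inverse\<close> is the pseudoinverse of a scalar.\<close>

lemma pinv_diag: "pinv (diag y) = diag (\<chi> i. inverse (y $ i))"
proof -
  have "moore_penrose (diag y) (diag (\<chi> i. inverse (y $ i)))"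
  proof -
    have scalar: "t * inverse t * t = t" "inverse t * t * inverse t = inverse t" for t :: real
      by (cases "t = 0"; simp)+
    show ?thesis
      by (simp only: moore_penrose_def diag_mult_diag transpose_diag vec_lambda_beta scalar
          vec_lambda_eta simp_thms)
  qed
  then show ?thesis
    unfolding pinv_def by (blast intro: moore_penrose_unique)
qed

lemma infnorm_eq_Max_cart: "infnorm (u :: real^'k) = (MAX i. \<bar>u $ i\<bar>)"
proof -
  have "{\<bar>u $ i\<bar> |i. i \<in> UNIV} = range (\<lambda>i. \<bar>u $ i\<bar>)" by auto
  then show ?thesis
    by (simp add: infnorm_cart cSup_eq_Max)
qed

lemma abs_matrix_nth: "\<bar>M :: real^'n^'m\<bar> $ i $ j = \<bar>M $ i $ j\<bar>"
  by (simp add: abs_vec_def)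

lemma matrix_le_iff: "(M :: real^'n^'m) \<le> M' \<longleftrightarrow> (\<forall>i j. M $ i $ j \<le> M' $ i $ j)"
  by (simp add: less_eq_vec_def)


text \<open>
  The admissible \<open>\<omega>\<close> form a closed set that is bounded below, so the least one exists and is
  itself admissible.
\<close>

lemma data_cnorm_eq_oneD:
  fixes A :: "real^'n^'m"
  assumes "data_cnorm (A, b) (dA, db) = 1"
  shows "\<bar>dA\<bar> \<le> \<bar>A\<bar>" and "\<bar>db\<bar> \<le> \<bar>b\<bar>"
proof -
  define Q where "Q w \<longleftrightarrow> 0 \<le> w \<and> \<bar>dA\<bar> \<le> w *\<^sub>R \<bar>A\<bar> \<and> \<bar>db\<bar> \<le> w *\<^sub>R \<bar>b\<bar>" for w :: real
  have "\<exists>w. Q w" and least: "(LEAST w. Q w) = 1"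
    using assms by (auto simp: data_cnorm_def Q_def one_ereal_def split: if_splits)
  have "closed {w. Q w}"
    unfolding Q_def less_eq_vec_def
    by (simp add: abs_vec_def)
      (intro closed_Collect_conj closed_Collect_all closed_Collect_le continuous_intros)
  moreover have "bdd_below {w. Q w}"
    by (auto simp: Q_def intro: bdd_belowI)
  ultimately have "Q (Inf {w. Q w})" and "\<And>w. Q w \<Longrightarrow> Inf {w. Q w} \<le> w"
    using \<open>\<exists>w. Q w\<close> closed_contains_Inf[of "{w. Q w}"] by (auto intro: cInf_lower)
  then have "Q (LEAST w. Q w)"
    by (metis Least_equality)
  then show "\<bar>dA\<bar> \<le> \<bar>A\<bar>" and "\<bar>db\<bar> \<le> \<bar>b\<bar>"
    unfolding least by (simp_all add: Q_def)
qed

lemma data_cnorm_eq_oneI: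
  fixes A :: "real^'n^'m"
  assumes "A \<noteq> 0" and "\<bar>dA\<bar> = \<bar>A\<bar>" and "\<bar>db\<bar> = \<bar>b\<bar>"
  shows "data_cnorm (A, b) (dA, db) = 1"
proof -
  define Q where "Q w \<longleftrightarrow> 0 \<le> w \<and> \<bar>dA\<bar> \<le> w *\<^sub>R \<bar>A\<bar> \<and> \<bar>db\<bar> \<le> w *\<^sub>R \<bar>b\<bar>" for w :: real
  obtain i j where entry: "A $ i $ j \<noteq> 0"
    using \<open>A \<noteq> 0\<close> by (auto simp: vec_eq_iff)
  have "Q 1" by (simp add: Q_def assms)
  moreover have "1 \<le> w" if "Q w" for w
  proof -
    have "\<bar>A $ i $ j\<bar> \<le> w * \<bar>A $ i $ j\<bar>"
      using that unfolding Q_def by (simp add: \<open>\<bar>dA\<bar> = \<bar>A\<bar>\<close> matrix_le_iff abs_matrix_nth)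
    then show ?thesis using entry by simp
  qed
  ultimately have "(LEAST w. Q w) = 1" and "\<exists>w. Q w"
    by (auto intro: Least_equality)
  then show ?thesis
    unfolding data_cnorm_def Q_def by (auto simp: one_ereal_def)
qed

lemma abs_matrix_vector_mult_le:
  fixes M :: "real^'q^'p"
  assumes "\<bar>v\<bar> \<le> w"
  shows "\<bar>(M *v v) $ i\<bar> \<le> (\<bar>M\<bar> *v w) $ i"
proof -
  have "\<bar>(M *v v) $ i\<bar> \<le> (\<Sum>j\<in>UNIV. \<bar>M $ i $ j * v $ j\<bar>)"
    by (simp add: matrix_vector_mult_def)
  also have "\<dots> \<le> (\<Sum>j\<in>UNIV. \<bar>M $ i $ j\<bar> * w $ j)"
    using assms by (intro sum_mono) (simp add: abs_mult less_eq_vec_def abs_vec_def mult_left_mono)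
  also have "\<dots> = (\<bar>M\<bar> *v w) $ i"
    by (simp add: matrix_vector_mult_def abs_vec_def)
  finally show ?thesis .
qed

lemma abs_vec_cols: "\<bar>vec_cols M\<bar> = vec_cols \<bar>M\<bar>"
  by (simp add: vec_cols_def abs_vec_def)

lemma vec_cols_mono: "M \<le> M' \<Longrightarrow> vec_cols M \<le> vec_cols M'"
  by (simp add: vec_cols_def less_eq_vec_def)

text \<open>
  Aligning the signs of the perturbation with those of row \<open>i\<close> of the derivative makes the
  triangle inequality an equality in that row. Zero entries get the sign 1, so that the
  perturbation has exactly the moduli of the data.
\<close>

lemma sign_aligned_perturbation:
  fixes M :: "real^('n::finite \<times> 'm::finite)^'k" and K :: "real^'m^'k" and A :: "real^'n^'m"
  obtains dA db where "\<bar>dA\<bar> = \<bar>A\<bar>" and "\<bar>db\<bar> = \<bar>b\<bar>"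
    and "(M *v vec_cols dA + K *v db) $ i = (\<bar>M\<bar> *v vec_cols \<bar>A\<bar> + \<bar>K\<bar> *v \<bar>b\<bar>) $ i"
proof
  define sg :: "real \<Rightarrow> real" where "sg t = (if t < 0 then - 1 else 1)" for t
  have sg: "\<bar>sg t\<bar> = 1" "t * (sg t * a) = \<bar>t\<bar> * a" for t a
    by (auto simp: sg_def)
  define dA :: "real^'n^'m" where "dA = (\<chi> l j. sg (M $ i $ (j, l)) * \<bar>A $ l $ j\<bar>)"
  define db :: "real^'m" where "db = (\<chi> l. sg (K $ i $ l) * \<bar>b $ l\<bar>)"
  show "\<bar>dA\<bar> = \<bar>A\<bar>" "\<bar>db\<bar> = \<bar>b\<bar>"
    by (simp_all add: dA_def db_def abs_vec_def abs_mult sg)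
  show "(M *v vec_cols dA + K *v db) $ i = (\<bar>M\<bar> *v vec_cols \<bar>A\<bar> + \<bar>K\<bar> *v \<bar>b\<bar>) $ i"
    by (simp add: matrix_vector_mult_def vec_cols_def dA_def db_def abs_vec_def sg)
qed

lemma row_kronecker_mult_vec_cols:
  "row_kronecker x B *v vec_cols M = B *v (M *v x)"
proof -
  have "(row_kronecker x B *v vec_cols M) $ i = (B *v (M *v x)) $ i" for i
  proof -
    have "(row_kronecker x B *v vec_cols M) $ i = (\<Sum>q\<in>UNIV. \<Sum>t\<in>UNIV. B $ i $ t * (M $ t $ q * x $ q))"
      by (simp add: row_kronecker_def kronecker_def vec_cols_def matrix_vector_mult_def
          rowvector_def sum.cartesian_product case_prod_unfold mult_ac)
    also have "\<dots> = (\<Sum>t\<in>UNIV. \<Sum>q\<in>UNIV. B $ i $ t * (M $ t $ q * x $ q))"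
      by (rule sum.swap)
    also have "\<dots> = (B *v (M *v x)) $ i"
      by (simp add: matrix_vector_mult_def sum_distrib_left)
    finally show ?thesis .
  qed
  then show ?thesis by (simp add: vec_eq_iff)
qed

lemma kronecker_row_mult_vec_cols:
  "kronecker_row C r *v vec_cols M = C *v (transpose M *v r)"
proof -
  have "(kronecker_row C r *v vec_cols M) $ i = (C *v (transpose M *v r)) $ i" for i
  proof -
    have "(kronecker_row C r *v vec_cols M) $ i = (\<Sum>q\<in>UNIV. \<Sum>t\<in>UNIV. C $ i $ q * (M $ t $ q * r $ t))"
      by (simp add: kronecker_row_def kronecker_def vec_cols_def matrix_vector_mult_def
          rowvector_def sum.cartesian_product case_prod_unfold mult_ac)
    also have "\<dots> = (C *v (transpose M *v r)) $ i"
      by (simp add: matrix_vector_mult_def transpose_def sum_distrib_left del: transpose_matrix_vector)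
    finally show ?thesis .
  qed
  then show ?thesis by (simp add: vec_eq_iff del: transpose_matrix_vector)
qed

lemma matrix_vector_mult_minus:
  fixes M :: "real^'n^'m"
  shows "M *v (- z) = - (M *v z)"
  using matrix_vector_mult_scaleR[of M "- 1" z] by simp

text \<open>
  The two Kronecker blocks of \<open>N\<close> write the terms \<open>K dA x\<close> and \<open>dA\<^sup>T r\<close> of the derivative, with
  \<open>K = A\<^sup>T + 2 x r\<^sup>T / (1 + x\<^sup>T x)\<close>, as matrices acting on the stacked columns of \<open>dA\<close>; so each
  component of the derivative is a linear form in the entries of the data.
\<close>

theorem tls_deriv_eq:
  fixes A :: "real^'n^'m" and b r :: "real^'m" and x :: "real^'n" and L :: "real^'n^'k"
    and P :: "real^'n^'n" and N :: "real^('n \<times> 'm)^'n" and H :: "real^'m^'n"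
  assumes size: "CARD('n) < CARD('m)" and gen: "tls_generic A b"
    and x: "x = tls_solution A b" and r: "r = b - A *v x"
    and P: "P = transpose A ** A - (smallest_singular_value (augment A b))\<^sup>2 *\<^sub>R mat 1"
    and N: "N = matrix_inv P **
           (row_kronecker (- x) (transpose A + (2 / (1 + x \<bullet> x)) *\<^sub>R outer_product x r)
            + kronecker_row (mat 1) r)"
    and H: "H = matrix_inv P ** (transpose A + (2 / (1 + x \<bullet> x)) *\<^sub>R outer_product x r)"
  shows "tls_deriv L A b (dA, db) = (L ** N) *v vec_cols dA + (L ** H) *v db"
proof -
  let ?K = "transpose A + (2 / (1 + x \<bullet> x)) *\<^sub>R outer_product x r"
  have "(tls_map L has_derivative (\<lambda>h. L *v (matrix_inv P *v (transpose (fst h) *v r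
      + ?K *v (snd h - fst h *v x))))) (at (A, b))"
    unfolding tls_map_def case_prod_unfold
    by (intro bounded_linear.has_derivative[OF matrix_vector_mul_bounded_linear]
        tls_solution_has_derivative assms)
  then have "tls_deriv L A b (dA, db)
      = L *v (matrix_inv P *v (transpose dA *v r + ?K *v (db - dA *v x)))"
    unfolding tls_deriv_def by (simp flip: frechet_derivative_at)
  also have "transpose dA *v r + ?K *v (db - dA *v x)
      = (row_kronecker (- x) ?K + kronecker_row (mat 1) r) *v vec_cols dA + ?K *v db"
  proof -
    have "dA *v (- x) = - (dA *v x)" and "?K *v (- (dA *v x)) = - (?K *v (dA *v x))"
      by (simp_all only: matrix_vector_mult_minus)
    then show ?thesis
      by (simp add: matrix_vector_mult_add_rdistrib[of "row_kronecker (- x) ?K"]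
          row_kronecker_mult_vec_cols kronecker_row_mult_vec_cols
          matrix_vector_mult_diff_distrib[of ?K] matrix_vector_right_distrib[of ?K]
          del: transpose_matrix_vector)
  qed
  finally show ?thesis
    unfolding N H by (simp only: matrix_vector_right_distrib matrix_vector_mul_assoc matrix_mul_assoc)
qed

theorem corollary3p3:
  fixes A :: "real^'n^'m" and b r :: "real^'m" and x :: "real^'n"
    and L :: "real^'n^'k"
    and P :: "real^'n^'n" and N :: "real^('n \<times> 'm)^'n" and H :: "real^'m^'n"
  assumes "CARD('n) < CARD('m)"
    and "CARD('k) \<le> CARD('n)"
    and "tls_generic A b"
    and "x = tls_solution A b"
    and "r = b - A *v x"
    and "P = transpose A ** A - (smallest_singular_value (augment A b))\<^sup>2 *\<^sub>R mat 1"
    and "N = matrix_inv P **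
           (row_kronecker (- x) (transpose A + (2 / (1 + x \<bullet> x)) *\<^sub>R outer_product x r)
            + kronecker_row (mat 1) r)"
    and "H = matrix_inv P ** (transpose A + (2 / (1 + x \<bullet> x)) *\<^sub>R outer_product x r)"
    and zero_components: "\<And>i dA db. (L *v x) $ i = 0 \<Longrightarrow> data_cnorm (A, b) (dA, db) < \<infinity> \<Longrightarrow>
           tls_deriv L A b (dA, db) $ i = 0"
  shows "tls_cond L A b =
    ereal (infnorm (pinv (diag (L *v x)) *v (\<bar>L ** N\<bar> *v vec_cols \<bar>A\<bar> + \<bar>L ** H\<bar> *v \<bar>b\<bar>)))"
proof -
  define y where "y = L *v x"
  define c where "c = \<bar>L ** N\<bar> *v vec_cols \<bar>A\<bar> + \<bar>L ** H\<bar> *v \<bar>b\<bar>"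
  have deriv: "tls_deriv L A b (dA, db) = (L ** N) *v vec_cols dA + (L ** H) *v db" for dA db
    using assms(1,3-8) by (rule tls_deriv_eq)
  have map: "tls_map L (A, b) = y"
    using assms(4) by (simp add: tls_map_def y_def)
  have amplification: "sol_cnorm (tls_map L (A, b)) (tls_deriv L A b (dA, db))
      = ereal (MAX i. \<bar>tls_deriv L A b (dA, db) $ i\<bar> / \<bar>y $ i\<bar>)"
    if "data_cnorm (A, b) (dA, db) = 1" for dA db
    unfolding map using that zero_components by (intro sol_cnorm_eq_Max) (simp add: y_def)
  have bound: "\<bar>tls_deriv L A b (dA, db) $ i\<bar> \<le> c $ i"
    if "data_cnorm (A, b) (dA, db) = 1" for dA db i
  proof -
    have "\<bar>((L ** N) *v vec_cols dA) $ i\<bar> \<le> (\<bar>L ** N\<bar> *v vec_cols \<bar>A\<bar>) $ i"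
      using data_cnorm_eq_oneD(1)[OF that]
      by (intro abs_matrix_vector_mult_le) (simp add: abs_vec_cols vec_cols_mono)
    moreover have "\<bar>((L ** H) *v db) $ i\<bar> \<le> (\<bar>L ** H\<bar> *v \<bar>b\<bar>) $ i"
      using data_cnorm_eq_oneD(2)[OF that] by (rule abs_matrix_vector_mult_le)
    ultimately show ?thesis
      unfolding deriv c_def by simp
  qed
  have max_bound: "(MAX i. \<bar>tls_deriv L A b (dA, db) $ i\<bar> / \<bar>y $ i\<bar>) \<le> (MAX i. c $ i / \<bar>y $ i\<bar>)"
    if "data_cnorm (A, b) (dA, db) = 1" for dA db
  proof -
    have "\<bar>tls_deriv L A b (dA, db) $ i\<bar> / \<bar>y $ i\<bar> \<le> (MAX i. c $ i / \<bar>y $ i\<bar>)" for i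
      by (rule order_trans[OF divide_right_mono[OF bound[OF that]] Max_ge]) auto
    then show ?thesis by (subst Max_le_iff) auto
  qed
  have "A \<noteq> 0"
  proof
    assume "A = 0"
    then have "tls_gap A b \<le> 0"
      using tls_gap_coercive[OF assms(1), of A b "axis undefined 1"] by (simp add: order_trans)
    then show False using assms(3) by (simp add: tls_generic_iff_gap[OF assms(1)])
  qed
  have infnorm_value: "infnorm (pinv (diag y) *v c) = (MAX i. c $ i / \<bar>y $ i\<bar>)"
  proof -
    have "0 \<le> c $ i" for i
      unfolding c_def using abs_matrix_vector_mult_le[of 0 "vec_cols \<bar>A\<bar>" "L ** N" i]
        abs_matrix_vector_mult_le[of 0 "\<bar>b\<bar>" "L ** H" i]
      by (simp add: vec_cols_def less_eq_vec_def abs_vec_def)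
    then show ?thesis
      unfolding infnorm_eq_Max_cart pinv_diag diag_mult_vec
      by (simp add: abs_mult divide_inverse mult.commute)
  qed
  have "tls_cond L A b = ereal (MAX i. c $ i / \<bar>y $ i\<bar>)"
    unfolding tls_cond_def
  proof (rule Greatest_equality)
    have "(MAX i. c $ i / \<bar>y $ i\<bar>) \<in> range (\<lambda>i. c $ i / \<bar>y $ i\<bar>)"
      by (rule Max_in) auto
    then obtain i where i: "(MAX i. c $ i / \<bar>y $ i\<bar>) = c $ i / \<bar>y $ i\<bar>"
      by (rule imageE)
    \<comment> \<open>aligning the signs in the row of the largest quotient suffices: the other rows obey the bound\<close>
    obtain dA db where moduli: "\<bar>dA\<bar> = \<bar>A\<bar>" "\<bar>db\<bar> = \<bar>b\<bar>" and aligned: "tls_deriv L A b (dA, db) $ i = c $ i"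
      unfolding deriv c_def by (rule sign_aligned_perturbation)
    have unit: "data_cnorm (A, b) (dA, db) = 1"
      by (rule data_cnorm_eq_oneI[OF \<open>A \<noteq> 0\<close> moduli])
    have "(MAX i. \<bar>tls_deriv L A b (dA, db) $ i\<bar> / \<bar>y $ i\<bar>) = (MAX i. c $ i / \<bar>y $ i\<bar>)"
    proof (rule antisym)
      show "(MAX i. \<bar>tls_deriv L A b (dA, db) $ i\<bar> / \<bar>y $ i\<bar>) \<le> (MAX i. c $ i / \<bar>y $ i\<bar>)"
        by (rule max_bound[OF unit])
      have "c $ i / \<bar>y $ i\<bar> \<le> \<bar>tls_deriv L A b (dA, db) $ i\<bar> / \<bar>y $ i\<bar>"
        unfolding aligned by (intro divide_right_mono) auto
      also have "\<dots> \<le> (MAX i. \<bar>tls_deriv L A b (dA, db) $ i\<bar> / \<bar>y $ i\<bar>)"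
        by (rule Max_ge) auto
      finally show "(MAX i. c $ i / \<bar>y $ i\<bar>) \<le> \<dots>"
        unfolding i .
    qed
    then show "\<exists>dA db. data_cnorm (A, b) (dA, db) = 1 \<and>
        ereal (MAX i. c $ i / \<bar>y $ i\<bar>) = sol_cnorm (tls_map L (A, b)) (tls_deriv L A b (dA, db))"
      using unit amplification[OF unit] by metis
  next
    fix \<kappa>
    assume "\<exists>dA db. data_cnorm (A, b) (dA, db) = 1 \<and>
        \<kappa> = sol_cnorm (tls_map L (A, b)) (tls_deriv L A b (dA, db))"
    then obtain dA db where unit: "data_cnorm (A, b) (dA, db) = 1"
      and \<kappa>: "\<kappa> = sol_cnorm (tls_map L (A, b)) (tls_deriv L A b (dA, db))" by blast
    show "\<kappa> \<le> ereal (MAX i. c $ i / \<bar>y $ i\<bar>)"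
      unfolding \<kappa> amplification[OF unit] ereal_less_eq by (rule max_bound[OF unit])
  qed
  then show ?thesis
    using infnorm_value by (simp add: y_def c_def)
qed

end
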